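(* Let $D\subset\mathbb{R}^d$ be a bounded domain, $H_0\in(0,1/2)$, and let $(X^H)_{0<H<H_0}$ be a family of normalized fractional Brownian fields on $D$ satisfying the standing assumptions (1) and (2) of the context. Let $A\subset D$ be measurable, $\gamma>0$ and $\alpha>\gamma$. Then for every $\varepsilon>0$ there exists $\bar H\in(0,H_0)$ sufficiently small such that $$\sup_{0<H\le\bar H/2}E\big[L^{H,\bar H}_{\alpha,\gamma}(A)\big]\le\varepsilon,$$ where $$L^{H,\bar H}_{\alpha,\gamma}(A)=\int_A e^{\gamma X^H(x)-\frac{\gamma^2}{2}E[X^H(x)^2]}\,\mathbf 1_{(G^{H,\bar H}_\alpha(x))^c}\,dx .$$
   Context: Let $D\subset\mathbb{R}^d$ be a bounded domain, $H_0\in(0,1/2)$, and let $\|\cdot\|$ be the Euclidean norm. A family of normalized fractional Brownian fields on $D$ is a family $(X^H(x))_{x\in D,\,0<H<H_0}$ of centred, jointly Gaussian random variables on a common probability space $(\Omega,\mathcal F,P)$ (each $X^H$ being a measurable field in $x$), with covariance $$E[X^H(x)X^h(y)]=C_{H,h}\Big(\frac{1-\|x-y\|^{H+h}}{H+h}+g^{H,h}(x,y)\Big),\qquad x,y\in D,\ H,h\in(0,H_0),$$ where $C_{H,h}>0$ are constants and $g^{H,h}:D\times D\to\mathbb{R}$ are bounded functions. Standing assumptions: (1) $\lim_{\bar H\to0}\big(\sup_{0<h,H<\bar H}|C_{h,H}-1|\big)=0$. (2) There is a bounded function $g:D\times D\to\mathbb{R}$ with $\lim_{(H,h)\to 0}\sup_{x,y\in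 D}|g^{H,h}(x,y)-g(x,y)|=0$ (limit in $\mathbb{R}^2$). Good points: for $\bar H\in(0,H_0)$, $0<H\le\bar H/2$ and $\alpha>0$, $$S_{H,\bar H}=\Big\{h:\ h=H+\tfrac1n,\ n\in\mathbb{N},\ \tfrac1{\bar H-H}<n\le\tfrac1H\Big\},\qquad G^{H,\bar H}_\alpha(x)=\Big\{X^h(x)\le\frac{\alpha}{h+H}\ \text{for all }h\in S_{H,\bar H}\Big\}.$$ *)

theory Defs
  imports "HOL-Probability.Probability"
begin

text \<open>Gaussian laws may be degenerate (point masses), as is needed for linear combinations.\<close>

definition gaussian_rv :: "'w measure \<Rightarrow> ('w \<Rightarrow> real) \<Rightarrow> bool" where
  "gaussian_rv M Y \<longleftrightarrow> Y \<in> borel_measurable M \<and>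
     ((\<exists>\<mu> \<sigma>. \<sigma> > 0 \<and> distributed M lborel Y (normal_density \<mu> \<sigma>)) \<or>
      (\<exists>\<mu>. AE \<omega> in M. Y \<omega> = \<mu>))"

definition jointly_gaussian :: "'w measure \<Rightarrow> 'i set \<Rightarrow> ('i \<Rightarrow> 'w \<Rightarrow> real) \<Rightarrow> bool" where
  "jointly_gaussian M I Y \<longleftrightarrow>
     (\<forall>J c. finite J \<longrightarrow> J \<subseteq> I \<longrightarrow> gaussian_rv M (\<lambda>\<omega>. \<Sum>j\<in>J. c j * Y j \<omega>))"

text \<open>\<open>X H x \<omega>\<close> is the value of the field with index \<open>H\<close> at the point \<open>x\<close>. A measurable field
  is one that is jointly measurable in \<open>(\<omega>, x)\<close>; only Lebesgue measurability in \<open>x\<close> is required.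
  On the diagonal, \<open>norm (x - x) powr (H + h) = 0\<close>.\<close>

locale fractional_brownian_fields = prob_space M
  for M :: "'w measure" +
  fixes D :: "'a::euclidean_space set"
    and H0 :: real
    and X :: "real \<Rightarrow> 'a \<Rightarrow> 'w \<Rightarrow> real"
    and C :: "real \<Rightarrow> real \<Rightarrow> real"
    and gg :: "real \<Rightarrow> real \<Rightarrow> 'a \<Rightarrow> 'a \<Rightarrow> real"
  assumes measurable_field:
      "H \<in> {0<..<H0} \<Longrightarrow>
         (\<lambda>(\<omega>, x). X H x \<omega>) \<in> borel_measurable (M \<Otimes>\<^sub>M lebesgue_on D)"
    and gaussian:
      "jointly_gaussian M ({0<..<H0} \<times> D) (\<lambda>(H, x). X H x)"
    and centred:
      "H \<in> {0<..<H0} \<Longrightarrow> x \<in> D \<Longrightarrow> expectation (X H x) = 0"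
    and C_pos:
      "H \<in> {0<..<H0} \<Longrightarrow> h \<in> {0<..<H0} \<Longrightarrow> C H h > 0"
    and gg_bounded:
      "H \<in> {0<..<H0} \<Longrightarrow> h \<in> {0<..<H0} \<Longrightarrow> bounded ((\<lambda>(x, y). gg H h x y) ` (D \<times> D))"
    and covariance:
      "H \<in> {0<..<H0} \<Longrightarrow> h \<in> {0<..<H0} \<Longrightarrow> x \<in> D \<Longrightarrow> y \<in> D \<Longrightarrow>
         expectation (\<lambda>\<omega>. X H x \<omega> * X h y \<omega>) =
           C H h * ((1 - norm (x - y) powr (H + h)) / (H + h) + gg H h x y)"

definition scales :: "real \<Rightarrow> real \<Rightarrow> real set" where
  "scales H Hbar = {h. \<exists>n::nat. h = H + 1 / real n \<and> 1 / (Hbar - H) < real n \<and> real n \<le> 1 / H}"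

definition good_event ::
    "'w measure \<Rightarrow> (real \<Rightarrow> 'a \<Rightarrow> 'w \<Rightarrow> real) \<Rightarrow> real \<Rightarrow> real \<Rightarrow> real \<Rightarrow> 'a \<Rightarrow> 'w set" where
  "good_event M X \<alpha> H Hbar x =
     {\<omega> \<in> space M. \<forall>h\<in>scales H Hbar. X h x \<omega> \<le> \<alpha> / (h + H)}"

text \<open>The integrand is nonnegative, so the integral is taken in \<open>[0, \<infinity>]\<close>, as is the expectation
  of the resulting random variable; no integrability is presupposed.\<close>

definition bad_mass ::
    "'w measure \<Rightarrow> (real \<Rightarrow> 'a::euclidean_space \<Rightarrow> 'w \<Rightarrow> real) \<Rightarrow>
     real \<Rightarrow> real \<Rightarrow> real \<Rightarrow> real \<Rightarrow> 'a set \<Rightarrow> 'w \<Rightarrow> ennreal" where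
  "bad_mass M X \<alpha> \<gamma> H Hbar A \<omega> =
     (\<integral>\<^sup>+x\<in>A. ennreal
        (exp (\<gamma> * X H x \<omega> - \<gamma>\<^sup>2 / 2 * (\<integral>\<omega>'. (X H x \<omega>')\<^sup>2 \<partial>M))
         * indicator (space M - good_event M X \<alpha> H Hbar x) \<omega>) \<partial>lebesgue)"

end

theory Submission
  imports Defs
begin

text \<open>Under the exponential tilting by \<open>X H x\<close>, the variable \<open>X h x\<close> gets mean
  \<open>\<gamma> E[X H x X h x]\<close>, about \<open>\<gamma> / (h + H)\<close>, while its variance is at most about \<open>1 / (h + H)\<close>.
  Exceeding \<open>\<alpha> / (h + H)\<close> with \<open>\<alpha> > \<gamma>\<close> is therefore a large deviation: the Chernoff bound with
  exponent \<open>\<lambda> = \<alpha> - \<gamma>\<close> gives it tilted probability at most a constant times \<open>exp (- c / (h + H))\<close>.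
  For \<open>h = H + 1/n\<close> with \<open>n \<le> 1/H\<close> one has \<open>1 / (h + H) \<ge> n/3\<close>, so the union bound over the scales
  is the tail of a geometric series starting beyond \<open>1/Hbar\<close>.\<close>

section \<open>The finite set of scale indices\<close>

lemma scale_indices:
  fixes H Hbar :: real
  assumes H: "0 < H" "H < Hbar"
  defines "T \<equiv> {n::nat. 1 / (Hbar - H) < real n \<and> real n \<le> 1 / H}"
  shows "finite T" "\<And>n. n \<in> T \<Longrightarrow> 0 < n" "\<And>n. n \<in> T \<Longrightarrow> 1 / real n < Hbar - H"
    "\<And>n. n \<in> T \<Longrightarrow> real n * H \<le> 1"
proof -
  show "finite T"
  proof (rule finite_subset)
    show "T \<subseteq> {..nat \<lceil>1 / H\<rceil>}"
      unfolding T_def by (auto, linarith)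
  qed simp
  fix n assume "n \<in> T"
  then have n: "1 / (Hbar - H) < real n" "real n \<le> 1 / H" by (auto simp: T_def)
  \<comment> \<open>The strict lower bound excludes n = 0, for which \<open>1 / real n\<close> would
    be 0 by convention and the scale would collapse to H.\<close>
  have "0 < 1 / (Hbar - H)" using H by simp
  then have "0 < real n" using n(1) by linarith
  then show "0 < n" by simp
  show "1 / real n < Hbar - H" "real n * H \<le> 1"
    using n \<open>0 < real n\<close> H by (simp_all add: field_simps)
qed

section \<open>Gaussian exponential moments\<close>

text \<open>Completing the square: weighting the centred density by \<open>exp y\<close> moves its
  mean to the variance and leaves a constant factor. This is the moment generating function at 1,
  which suffices because coefficients can be absorbed into the variable.\<close>

lemma nn_integral_exp_normal_density:
  assumes "\<sigma> > 0"
  shows "(\<integral>\<^sup>+y. ennreal (normal_density 0 \<sigma> y) * ennreal (exp y) \<partial>lborel) = ennreal (exp (\<sigma>\<^sup>2 / 2))"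
proof -
  have "normal_density 0 \<sigma> y * exp y = exp (\<sigma>\<^sup>2 / 2) * normal_density (\<sigma>\<^sup>2) \<sigma> y" for y
  proof -
    have "- (y\<^sup>2 / (2 * \<sigma>\<^sup>2)) + y = \<sigma>\<^sup>2 / 2 - (y - \<sigma>\<^sup>2)\<^sup>2 / (2 * \<sigma>\<^sup>2)"
      using assms by (simp add: field_simps power2_eq_square)
    then have "exp (- (y\<^sup>2 / (2 * \<sigma>\<^sup>2))) * exp y
        = exp (\<sigma>\<^sup>2 / 2) * exp (- ((y - \<sigma>\<^sup>2)\<^sup>2 / (2 * \<sigma>\<^sup>2)))"
      by (simp flip: exp_add)
    then show ?thesis
      by (simp add: normal_density_def field_simps)
  qed
  then have "(\<integral>\<^sup>+y. ennreal (normal_density 0 \<sigma> y) * ennreal (exp y) \<partial>lborel)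
      = (\<integral>\<^sup>+y. ennreal (exp (\<sigma>\<^sup>2 / 2)) * ennreal (normal_density (\<sigma>\<^sup>2) \<sigma> y) \<partial>lborel)"
    by (simp flip: ennreal_mult)
  also have "\<dots> = ennreal (exp (\<sigma>\<^sup>2 / 2)) * (\<integral>\<^sup>+y. ennreal (normal_density (\<sigma>\<^sup>2) \<sigma> y) \<partial>lborel)"
    by (rule nn_integral_cmult) simp
  also have "(\<integral>\<^sup>+y. ennreal (normal_density (\<sigma>\<^sup>2) \<sigma> y) \<partial>lborel) = 1"
    using prob_space.emeasure_space_1[OF prob_space_normal_density[OF assms, of "\<sigma>\<^sup>2"]]
    by (simp add: emeasure_density)
  finally show ?thesis by simp
qed

context prob_space
begin

text \<open>Needed before expanding the second moment of a linear combination: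
  \<open>expectation\<close> is linear only on integrable terms.\<close>

lemma gaussian_rv_integrable:
  assumes "gaussian_rv M Y"
  shows "integrable M Y" "integrable M (\<lambda>\<omega>. (Y \<omega>)\<^sup>2)"
proof -
  have Y[measurable]: "Y \<in> borel_measurable M"
    using assms by (simp add: gaussian_rv_def)
  have "integrable M Y \<and> integrable M (\<lambda>\<omega>. (Y \<omega>)\<^sup>2)"
  proof -
    consider (density) \<mu> \<sigma> where "\<sigma> > 0" "distributed M lborel Y (normal_density \<mu> \<sigma>)"
      | (const) \<mu> where "AE \<omega> in M. Y \<omega> = \<mu>"
      using assms by (auto simp: gaussian_rv_def)
    then show ?thesis
    proof cases
      case density
      have "integrable lborel (\<lambda>y. normal_density \<mu> \<sigma> y * y)"
        using integrable_normal_moment_nz_1[OF density(1)] .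
      moreover have "integrable lborel (\<lambda>y. normal_density \<mu> \<sigma> y * y\<^sup>2)"
      proof -
        \<comment> \<open>The square of y is split into the central square, a multiple of y and a
          constant, each integrable against the density.\<close>
        have "integrable lborel (\<lambda>y. normal_density \<mu> \<sigma> y * (y - \<mu>)\<^sup>2
            + (2 * \<mu>) * (normal_density \<mu> \<sigma> y * y) - \<mu>\<^sup>2 * normal_density \<mu> \<sigma> y)"
          using integrable_normal_moment[OF density(1), of \<mu> 2] density
            integrable_normal_moment_nz_1[OF density(1)]
          by (intro Bochner_Integration.integrable_diff Bochner_Integration.integrable_add
              integrable_mult_right) auto
        then show ?thesis
          by (rule Bochner_Integration.integrable_cong[THEN iffD1, rotated 2])
            (auto simp: power2_eq_square algebra_simps)
      qed
      ultimately show ?thesis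
        using distributed_integrable[OF density(2), of "\<lambda>y. y"]
          distributed_integrable[OF density(2), of "\<lambda>y. y\<^sup>2"] by auto
    next
      case const
      have "integrable M Y \<longleftrightarrow> integrable M (\<lambda>_. \<mu>)"
        by (rule integrable_cong_AE) (use const in auto)
      moreover have "integrable M (\<lambda>\<omega>. (Y \<omega>)\<^sup>2) \<longleftrightarrow> integrable M (\<lambda>_. \<mu>\<^sup>2)"
        by (rule integrable_cong_AE) (use const in auto)
      ultimately show ?thesis by simp
    qed
  qed
  then show "integrable M Y" "integrable M (\<lambda>\<omega>. (Y \<omega>)\<^sup>2)" by auto
qed

text \<open>Mean zero forces \<mu> = 0 in both alternatives. The density case is then the integral
  computed above, and in the degenerate case both sides equal 1.\<close>

lemma gaussian_rv_exp_moment: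
  assumes "gaussian_rv M Y" and mean: "expectation Y = 0"
  shows "(\<integral>\<^sup>+\<omega>. ennreal (exp (Y \<omega>)) \<partial>M) = ennreal (exp (expectation (\<lambda>\<omega>. (Y \<omega>)\<^sup>2) / 2))"
proof -
  have Y[measurable]: "Y \<in> borel_measurable M"
    using assms by (simp add: gaussian_rv_def)
  consider (density) \<mu> \<sigma> where "\<sigma> > 0" "distributed M lborel Y (normal_density \<mu> \<sigma>)"
    | (const) \<mu> where "AE \<omega> in M. Y \<omega> = \<mu>"
    using assms by (auto simp: gaussian_rv_def)
  then show ?thesis
  proof cases
    case density
    have "\<mu> = 0"
      using normal_distributed_expectation[OF density(1,2)] mean by simp
    moreover have "expectation (\<lambda>\<omega>. (Y \<omega>)\<^sup>2) = \<sigma>\<^sup>2"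
      using normal_distributed_variance[OF density(1,2)] mean by simp
    ultimately show ?thesis
      using distributed_nn_integral[OF density(2), of "\<lambda>y. ennreal (exp y)"]
        nn_integral_exp_normal_density[OF density(1)] by simp
  next
    case const
    have "expectation Y = expectation (\<lambda>_. \<mu>)"
      using const by (intro integral_cong_AE) auto
    then have "\<mu> = 0"
      using mean by (simp add: prob_space)
    with const have Y0: "AE \<omega> in M. Y \<omega> = 0" by simp
    then have "expectation (\<lambda>\<omega>. (Y \<omega>)\<^sup>2) = expectation (\<lambda>_. 0)"
      by (intro integral_cong_AE) auto
    moreover have "(\<integral>\<^sup>+\<omega>. ennreal (exp (Y \<omega>)) \<partial>M) = (\<integral>\<^sup>+\<omega>. 1 \<partial>M)"
      using Y0 by (intro nn_integral_cong_AE) auto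
    ultimately show ?thesis
      by (simp add: emeasure_space_1)
  qed
qed

end

section \<open>Exponential tilting and the union bound for the fields\<close>

context fractional_brownian_fields
begin

lemma gaussian_rv_field:
  assumes "H \<in> {0<..<H0}" "x \<in> D"
  shows "gaussian_rv M (X H x)"
  using gaussian[unfolded jointly_gaussian_def, rule_format, of "{(H, x)}" "\<lambda>_. 1"] assms by simp

lemma borel_measurable_field:
  assumes "H \<in> {0<..<H0}" "x \<in> D"
  shows "X H x \<in> borel_measurable M"
  using gaussian_rv_field[OF assms] by (simp add: gaussian_rv_def)

text \<open>By joint Gaussianity the exponent is a centred Gaussian variable, so half its variance
  determines the moment. Since H and h differ, the index set has two elements and carries the two
  coefficients separately.\<close>

lemma exp_moment_two_fields:
  assumes "H \<in> {0<..<H0}" "h \<in> {0<..<H0}" "H \<noteq> h" "x \<in> D"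
  shows "(\<integral>\<^sup>+\<omega>. ennreal (exp (a * X H x \<omega> + b * X h x \<omega>)) \<partial>M) =
    ennreal (exp (a\<^sup>2 / 2 * expectation (\<lambda>\<omega>. (X H x \<omega>)\<^sup>2)
      + a * b * expectation (\<lambda>\<omega>. X H x \<omega> * X h x \<omega>)
      + b\<^sup>2 / 2 * expectation (\<lambda>\<omega>. (X h x \<omega>)\<^sup>2)))"
proof -
  note [measurable] = borel_measurable_field[OF assms(1,4)] borel_measurable_field[OF assms(2,4)]
  note int1 = gaussian_rv_integrable[OF gaussian_rv_field[OF assms(1,4)]]
  note int2 = gaussian_rv_integrable[OF gaussian_rv_field[OF assms(2,4)]]
  \<comment> \<open>Both factors are square integrable, and the product is dominated by the sum of
    the squares.\<close>
  have prod: "integrable M (\<lambda>\<omega>. X H x \<omega> * X h x \<omega>)"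
  proof (rule Bochner_Integration.integrable_bound)
    show "integrable M (\<lambda>\<omega>. (X H x \<omega>)\<^sup>2 + (X h x \<omega>)\<^sup>2)"
      using int1 int2 by simp
    have "\<bar>s * t\<bar> \<le> s\<^sup>2 + t\<^sup>2" for s t :: real
    proof -
      have "2 * (\<bar>s\<bar> * \<bar>t\<bar>) \<le> s\<^sup>2 + t\<^sup>2"
        using sum_squares_bound[of "\<bar>s\<bar>" "\<bar>t\<bar>"] by (simp add: mult.assoc)
      moreover have "0 \<le> \<bar>s\<bar> * \<bar>t\<bar>" by simp
      ultimately show ?thesis unfolding abs_mult by linarith
    qed
    then show "AE \<omega> in M. norm (X H x \<omega> * X h x \<omega>) \<le> norm ((X H x \<omega>)\<^sup>2 + (X h x \<omega>)\<^sup>2)"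
      by simp
  qed simp
  let ?Y = "\<lambda>\<omega>. a * X H x \<omega> + b * X h x \<omega>"
  have "gaussian_rv M ?Y"
    using gaussian[unfolded jointly_gaussian_def, rule_format, of "{(H, x), (h, x)}"
        "\<lambda>j. if j = (H, x) then a else b"] assms by simp
  moreover have "expectation ?Y = 0"
    using int1 int2 centred assms by simp
  moreover have "expectation (\<lambda>\<omega>. (?Y \<omega>)\<^sup>2) = a\<^sup>2 * expectation (\<lambda>\<omega>. (X H x \<omega>)\<^sup>2)
      + 2 * a * b * expectation (\<lambda>\<omega>. X H x \<omega> * X h x \<omega>) + b\<^sup>2 * expectation (\<lambda>\<omega>. (X h x \<omega>)\<^sup>2)"
  proof -
    have "(\<lambda>\<omega>. (?Y \<omega>)\<^sup>2) = (\<lambda>\<omega>. a\<^sup>2 * (X H x \<omega>)\<^sup>2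
        + 2 * a * b * (X H x \<omega> * X h x \<omega>) + b\<^sup>2 * (X h x \<omega>)\<^sup>2)"
      by (auto simp: power2_eq_square algebra_simps)
    then show ?thesis
      using int1 int2 prod by simp
  qed
  ultimately show ?thesis
    using gaussian_rv_exp_moment[of ?Y] by (simp add: algebra_simps add_divide_distrib)
qed

text \<open>The normalisation cancels the variance of \<open>X H x\<close>. What remains is the
  cross term, which is the mean shift of \<open>X h x\<close> under tilting, and the variance of
  \<open>X h x\<close>. On the diagonal the covariance formula loses its norm term.\<close>

lemma tilted_chernoff:
  assumes "H \<in> {0<..<H0}" "h \<in> {0<..<H0}" "H \<noteq> h" "x \<in> D"
  shows "(\<integral>\<^sup>+\<omega>. ennreal (exp (\<gamma> * X H x \<omega> - \<gamma>\<^sup>2 / 2 * expectation (\<lambda>\<omega>. (X H x \<omega>)\<^sup>2))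
      * exp (l * (X h x \<omega> - t))) \<partial>M) =
    ennreal (exp (l * (\<gamma> * (C H h * (1 / (H + h) + gg H h x x))
      + l / 2 * (C h h * (1 / (2 * h) + gg h h x x)) - t)))"
proof -
  note [measurable] = borel_measurable_field[OF assms(1,4)] borel_measurable_field[OF assms(2,4)]
  let ?V = "expectation (\<lambda>\<omega>. (X H x \<omega>)\<^sup>2)"
  have cov: "expectation (\<lambda>\<omega>. X H x \<omega> * X h x \<omega>) = C H h * (1 / (H + h) + gg H h x x)"
    using covariance[OF assms(1,2,4,4)] by simp
  have var: "expectation (\<lambda>\<omega>. (X h x \<omega>)\<^sup>2) = C h h * (1 / (2 * h) + gg h h x x)"
    using covariance[OF assms(2,2,4,4)] by (simp add: power2_eq_square)
  have "(\<integral>\<^sup>+\<omega>. ennreal (exp (\<gamma> * X H x \<omega> - \<gamma>\<^sup>2 / 2 * ?V) * exp (l * (X h x \<omega> - t))) \<partial>M)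
     = (\<integral>\<^sup>+\<omega>. ennreal (exp (- (\<gamma>\<^sup>2 / 2 * ?V) - l * t)) * ennreal (exp (\<gamma> * X H x \<omega> + l * X h x \<omega>)) \<partial>M)"
    by (simp add: algebra_simps flip: ennreal_mult exp_add)
  also have "\<dots> = ennreal (exp (- (\<gamma>\<^sup>2 / 2 * ?V) - l * t))
      * (\<integral>\<^sup>+\<omega>. ennreal (exp (\<gamma> * X H x \<omega> + l * X h x \<omega>)) \<partial>M)"
    by (rule nn_integral_cmult) simp
  also have "\<dots> = ennreal (exp (l * (\<gamma> * (C H h * (1 / (H + h) + gg H h x x))
      + l / 2 * (C h h * (1 / (2 * h) + gg h h x x)) - t)))"
    unfolding exp_moment_two_fields[OF assms] cov var
    by (simp add: power2_eq_square algebra_simps flip: ennreal_mult exp_add)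
  finally show ?thesis .
qed

text \<open>Markov's inequality and the union bound in pointwise form: on the bad event some scale
  exceeds its threshold, so its exponential is at least 1. Integrating this bound avoids any
  measurability question about the bad event.\<close>

lemma indicator_bad_event_le:
  assumes T: "T = {n::nat. 1 / (Hbar - H) < real n \<and> real n \<le> 1 / H}" "finite T" and "l \<ge> 0"
  shows "indicator (space M - good_event M X \<alpha> H Hbar x) \<omega>
    \<le> (\<Sum>n\<in>T. exp (l * (X (H + 1 / real n) x \<omega> - \<alpha> / (H + 1 / real n + H))))"
proof (cases "\<omega> \<in> space M - good_event M X \<alpha> H Hbar x")
  case True
  then obtain n where n: "n \<in> T" "X (H + 1 / real n) x \<omega> > \<alpha> / (H + 1 / real n + H)"
    by (auto simp: good_event_def scales_def T not_le)
  let ?f = "\<lambda>n. exp (l * (X (H + 1 / real n) x \<omega> - \<alpha> / (H + 1 / real n + H)))"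
  have "1 \<le> ?f n"
    using n \<open>l \<ge> 0\<close> by simp
  also have "\<dots> \<le> sum ?f T"
    using n T by (intro member_le_sum) auto
  finally show ?thesis using True by simp
qed (simp add: sum_nonneg)

text \<open>The pointwise bound on the indicator, Tonelli's theorem and the tilted Chernoff estimate
  at each x combine to a sum over scales times the volume of D. The logarithmic form of
  \<open>bound\<close> matches the exponent that is estimated later.\<close>

lemma expected_bad_mass_le:
  assumes D: "D \<in> sets lebesgue" "emeasure lebesgue D \<noteq> \<infinity>"
    and H: "0 < H" "H < Hbar" "Hbar \<le> H0" and "A \<subseteq> D" and l: "l \<ge> 0"
    and T: "T = {n::nat. 1 / (Hbar - H) < real n \<and> real n \<le> 1 / H}"
    and bound: "\<And>n x. n \<in> T \<Longrightarrow> x \<in> D \<Longrightarrow>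
      l * (\<gamma> * (C H (H + 1 / real n) * (1 / (H + (H + 1 / real n)) + gg H (H + 1 / real n) x x))
        + l / 2 * (C (H + 1 / real n) (H + 1 / real n)
            * (1 / (2 * (H + 1 / real n)) + gg (H + 1 / real n) (H + 1 / real n) x x))
        - \<alpha> / (H + 1 / real n + H)) \<le> ln (B n)"
    and B: "\<And>n. B n > 0"
  shows "(\<integral>\<^sup>+\<omega>. bad_mass M X \<alpha> \<gamma> H Hbar A \<omega> \<partial>M) \<le> (\<Sum>n\<in>T. ennreal (B n)) * emeasure lebesgue D"
proof -
  note T_props = scale_indices[OF H(1,2), folded T]
  note finT = T_props(1)
  have scale: "H + 1 / real n \<in> {0<..<H0}" "H \<noteq> H + 1 / real n" if "n \<in> T" for n
    using T_props(2,3)[OF that] H by (auto intro!: add_pos_pos)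
  have HH: "H \<in> {0<..<H0}" using H by simp
  have DD: "D \<inter> space lebesgue \<in> sets lebesgue" using D by simp
  have fin: "finite_measure (lebesgue_on D)"
    using D by (intro finite_measureI) (simp add: emeasure_restrict_space)
  interpret N: finite_measure "lebesgue_on D" by fact
  interpret P: pair_sigma_finite M "lebesgue_on D" ..
  define V where "V = (\<lambda>x. expectation (\<lambda>\<omega>. (X H x \<omega>)\<^sup>2))"
  define f where "f = (\<lambda>\<omega> x n. exp (\<gamma> * X H x \<omega> - \<gamma>\<^sup>2 / 2 * V x)
      * exp (l * (X (H + 1 / real n) x \<omega> - \<alpha> / (H + 1 / real n + H))))"
  \<comment> \<open>Joint measurability, with x as first coordinate, makes the integral over
    \<omega> measurable in x.\<close>
  have [measurable]: "V \<in> borel_measurable (lebesgue_on D)"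
  proof -
    have "(\<lambda>(x, \<omega>). X H x \<omega>) \<in> borel_measurable (lebesgue_on D \<Otimes>\<^sub>M M)"
      using measurable_pair_swap[OF measurable_field[OF HH]] by simp
    then have "(\<lambda>(x, \<omega>). (X H x \<omega>)\<^sup>2) \<in> borel_measurable (lebesgue_on D \<Otimes>\<^sub>M M)"
      by (simp add: case_prod_unfold)
    then show ?thesis
      unfolding V_def by (rule borel_measurable_lebesgue_integral)
  qed
  have f_meas: "(\<lambda>(\<omega>, x). ennreal (f \<omega> x n)) \<in> borel_measurable (M \<Otimes>\<^sub>M lebesgue_on D)"
    if "n \<in> T" for n
    using measurable_field[OF HH] measurable_field[OF scale(1)[OF that]]
    unfolding f_def by (simp add: case_prod_unfold)
  \<comment> \<open>Enlarging A to D gives an integral over the space on which the fields are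
    jointly measurable, so that Tonelli applies.\<close>
  have pointwise: "bad_mass M X \<alpha> \<gamma> H Hbar A \<omega> \<le> (\<integral>\<^sup>+x. (\<Sum>n\<in>T. ennreal (f \<omega> x n)) \<partial>lebesgue_on D)"
    for \<omega>
  proof -
    have "bad_mass M X \<alpha> \<gamma> H Hbar A \<omega>
        \<le> (\<integral>\<^sup>+x. (\<Sum>n\<in>T. ennreal (f \<omega> x n)) * indicator D x \<partial>lebesgue)"
      unfolding bad_mass_def
    proof (intro nn_integral_mono mult_mono)
      fix x
      show "ennreal (exp (\<gamma> * X H x \<omega> - \<gamma>\<^sup>2 / 2 * expectation (\<lambda>\<omega>'. (X H x \<omega>')\<^sup>2))
           * indicator (space M - good_event M X \<alpha> H Hbar x) \<omega>) \<le> (\<Sum>n\<in>T. ennreal (f \<omega> x n))"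
        using indicator_bad_event_le[OF T finT l, of \<alpha> x \<omega>]
        by (simp add: f_def V_def sum_nonneg flip: sum_distrib_left)
      show "indicator A x \<le> (indicator D x :: ennreal)"
        using \<open>A \<subseteq> D\<close> by (auto simp: indicator_def)
    qed auto
    then show ?thesis
      by (simp add: nn_integral_restrict_space[OF DD])
  qed
  have "(\<integral>\<^sup>+\<omega>. bad_mass M X \<alpha> \<gamma> H Hbar A \<omega> \<partial>M)
      \<le> (\<integral>\<^sup>+\<omega>. (\<integral>\<^sup>+x. (\<Sum>n\<in>T. ennreal (f \<omega> x n)) \<partial>lebesgue_on D) \<partial>M)"
    by (intro nn_integral_mono pointwise)
  also have "\<dots> = (\<integral>\<^sup>+x. (\<integral>\<^sup>+\<omega>. (\<Sum>n\<in>T. ennreal (f \<omega> x n)) \<partial>M) \<partial>lebesgue_on D)"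
    using f_meas by (intro P.Fubini'[symmetric]) (auto simp: case_prod_unfold)
  also have "\<dots> \<le> (\<integral>\<^sup>+x. (\<Sum>n\<in>T. ennreal (B n)) \<partial>lebesgue_on D)"
  proof (rule nn_integral_mono)
    fix x assume "x \<in> space (lebesgue_on D)"
    then have x: "x \<in> D" by simp
    have "(\<lambda>\<omega>. ennreal (f \<omega> x n)) \<in> borel_measurable M" if "n \<in> T" for n
      using borel_measurable_field[OF HH x] borel_measurable_field[OF scale(1)[OF that] x]
      unfolding f_def by simp
    then have "(\<integral>\<^sup>+\<omega>. (\<Sum>n\<in>T. ennreal (f \<omega> x n)) \<partial>M) = (\<Sum>n\<in>T. \<integral>\<^sup>+\<omega>. ennreal (f \<omega> x n) \<partial>M)"
      by (rule nn_integral_sum)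
    also have "\<dots> \<le> (\<Sum>n\<in>T. ennreal (B n))"
    proof (rule sum_mono)
      fix n assume n: "n \<in> T"
      show "(\<integral>\<^sup>+\<omega>. ennreal (f \<omega> x n) \<partial>M) \<le> ennreal (B n)"
        unfolding f_def V_def tilted_chernoff[OF HH scale[OF n] x]
        using bound[OF n x] B[of n] by (intro ennreal_leI) (simp add: ln_ge_iff)
    qed
    finally show "(\<integral>\<^sup>+\<omega>. (\<Sum>n\<in>T. ennreal (f \<omega> x n)) \<partial>M) \<le> (\<Sum>n\<in>T. ennreal (B n))" .
  qed
  also have "\<dots> = (\<Sum>n\<in>T. ennreal (B n)) * emeasure lebesgue D"
    using D by (simp add: emeasure_restrict_space)
  finally show ?thesis .
qed

end

section \<open>Deterministic estimates: exponent and geometric tail\<close>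

text \<open>Used with u = 1/(h+H) and v = 1/(2h). If c = c' = 1 and k = k' = 0, the first two terms
  are at most (\<alpha>+\<gamma>)/2 times u, a gap of (\<alpha>-\<gamma>)/2 below \<alpha>. The
  slack allowed in c and c' spends exactly half of that gap.\<close>

lemma chernoff_exponent_le:
  fixes \<alpha> \<gamma> c c' u v k k' K :: real
  assumes "\<gamma> > 0" "\<alpha> > \<gamma>" "K \<ge> 0" "\<bar>k\<bar> \<le> K" "\<bar>k'\<bar> \<le> K" "0 < v" "v \<le> u"
    and c: "0 < c" "c \<le> 1 + (\<alpha> - \<gamma>) / (2 * (\<alpha> + \<gamma>))" "0 < c'" "c' \<le> 1 + (\<alpha> - \<gamma>) / (2 * (\<alpha> + \<gamma>))"
  shows "\<gamma> * (c * (u + k)) + (\<alpha> - \<gamma>) / 2 * (c' * (v + k')) - \<alpha> * u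
    \<le> \<alpha> * K - (\<alpha> - \<gamma>) / 4 * u"
proof -
  define q where "q = 1 + (\<alpha> - \<gamma>) / (2 * (\<alpha> + \<gamma>))"
  have "c * (u + k) \<le> q * (u + K)" "c' * (v + k') \<le> q * (u + K)"
  proof -
    have "0 \<le> q" using c by (simp add: q_def)
    \<comment> \<open>The second factors are enlarged first, using positive c and c'; only then are
      c and c' replaced by q, because \<open>u + K\<close> is nonnegative whereas
      \<open>u + k\<close> may be negative.\<close>
    have "c * (u + k) \<le> c * (u + K)" "c' * (v + k') \<le> c' * (u + K)"
      using assms by (auto intro!: mult_left_mono)
    moreover have "c * (u + K) \<le> q * (u + K)" "c' * (u + K) \<le> q * (u + K)"
      using assms by (auto intro!: mult_right_mono simp: q_def)
    ultimately show "c * (u + k) \<le> q * (u + K)" "c' * (v + k') \<le> q * (u + K)" by linarith+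
  qed
  then have "\<gamma> * (c * (u + k)) + (\<alpha> - \<gamma>) / 2 * (c' * (v + k'))
      \<le> \<gamma> * (q * (u + K)) + (\<alpha> - \<gamma>) / 2 * (q * (u + K))"
    using assms by (intro add_mono mult_left_mono) auto
  also have "\<dots> = ((\<alpha> + \<gamma>) / 2 * q) * (u + K)"
    by (simp add: field_simps)
  also have "(\<alpha> + \<gamma>) / 2 * q = \<alpha> - (\<alpha> - \<gamma>) / 4"
    using assms by (simp add: q_def field_simps)
  also have "(\<alpha> - (\<alpha> - \<gamma>) / 4) * (u + K) = \<alpha> * u - (\<alpha> - \<gamma>) / 4 * u + \<alpha> * K - (\<alpha> - \<gamma>) / 4 * K"
    by (simp add: field_simps)
  also have "\<dots> \<le> \<alpha> * u - (\<alpha> - \<gamma>) / 4 * u + \<alpha> * K"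
    using assms by simp
  finally show ?thesis by simp
qed

text \<open>After factoring out \<open>r ^ N\<close>, the shift by N is injective on T because
  truncated subtraction is exact there, and a finite partial sum lies below the full geometric
  series.\<close>

lemma geometric_tail_le:
  fixes r :: real
  assumes "0 \<le> r" "r < 1" "finite T" "\<And>n. n \<in> T \<Longrightarrow> N \<le> n"
  shows "(\<Sum>n\<in>T. r ^ n) \<le> r ^ N / (1 - r)"
proof -
  have "(\<Sum>n\<in>T. r ^ n) = (\<Sum>n\<in>T. r ^ N * r ^ (n - N))"
    using assms(4) by (intro sum.cong) (auto simp flip: power_add)
  also have "\<dots> = r ^ N * (\<Sum>m\<in>(\<lambda>n. n - N) ` T. r ^ m)"
    using assms(4) by (subst sum.reindex) (auto simp: sum_distrib_left inj_on_def, metis le_add_diff_inverse)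
  also have "\<dots> \<le> r ^ N * (\<Sum>m. r ^ m)"
    using assms by (intro mult_left_mono sum_le_suminf summable_geometric) auto
  also have "\<dots> = r ^ N / (1 - r)"
    using assms by (simp add: suminf_geometric)
  finally show ?thesis .
qed

section \<open>Uniform bounds from the standing assumptions\<close>

lemma constants_bounded_near_zero:
  fixes C :: "real \<Rightarrow> real \<Rightarrow> real"
  assumes "((\<lambda>Hbar. SUP (h, H)\<in>{0<..<Hbar} \<times> {0<..<Hbar}. ennreal \<bar>C h H - 1\<bar>) \<longlongrightarrow> 0) (at_right 0)"
    and "\<delta> > 0"
  obtains b where "b > 0" "\<And>h H. h \<in> {0<..<b} \<Longrightarrow> H \<in> {0<..<b} \<Longrightarrow> C h H \<le> 1 + \<delta>"
proof -
  have "eventually (\<lambda>Hbar. (SUP (h, H)\<in>{0<..<Hbar} \<times> {0<..<Hbar}. ennreal \<bar>C h H - 1\<bar>) < ennreal \<delta>)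
      (at_right 0)"
    using assms by (intro order_tendstoD(2)) auto
  then obtain b where b: "b > 0" "\<And>y. 0 < y \<Longrightarrow> y < b \<Longrightarrow>
      (SUP (h, H)\<in>{0<..<y} \<times> {0<..<y}. ennreal \<bar>C h H - 1\<bar>) < ennreal \<delta>"
    unfolding eventually_at_right_field by auto
  show ?thesis
  \<comment> \<open>One admissible value of y suffices, since the supremum controls the whole
    square; b itself is excluded by the strict inequality, hence its half.\<close>
  proof (rule that[of "b / 2"])
    fix h H assume hH: "h \<in> {0<..<b/2}" "H \<in> {0<..<b/2}"
    have "ennreal \<bar>C h H - 1\<bar> \<le> (SUP (h, H)\<in>{0<..<b/2} \<times> {0<..<b/2}. ennreal \<bar>C h H - 1\<bar>)"
      using hH by (intro SUP_upper2[of "(h, H)"]) auto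
    also have "\<dots> < ennreal \<delta>" using b by auto
    finally show "C h H \<le> 1 + \<delta>" by (simp add: ennreal_less_iff)
  qed (use b in simp)
qed

text \<open>Near the origin every kernel is within 1 of the bounded limit g, which gives one
  constant for all indices and all points.\<close>

lemma kernels_bounded_near_zero:
  fixes gg :: "real \<Rightarrow> real \<Rightarrow> 'a \<Rightarrow> 'a \<Rightarrow> real"
  assumes "((\<lambda>(H, h). SUP (x, y)\<in>D \<times> D. ennreal \<bar>gg H h x y - g x y\<bar>) \<longlongrightarrow> 0)
      (at (0, 0) within {0<..<H0} \<times> {0<..<H0})"
    and "bounded ((\<lambda>(x, y). g x y) ` (D \<times> D))" and "H0 > 0"
  obtains b K where "0 < b" "b \<le> H0" "0 \<le> K"
    "\<And>H h x y. H \<in> {0<..<b} \<Longrightarrow> h \<in> {0<..<b} \<Longrightarrow> x \<in> D \<Longrightarrow> y \<in> D \<Longrightarrow> \<bar>gg H h x y\<bar> \<le> K"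
proof -
  obtain L where L: "L > 0" "\<And>x y. x \<in> D \<Longrightarrow> y \<in> D \<Longrightarrow> \<bar>g x y\<bar> \<le> L"
    using assms(2) unfolding bounded_pos by fastforce
  have "eventually (\<lambda>p. (case p of (H, h) \<Rightarrow> SUP (x, y)\<in>D \<times> D. ennreal \<bar>gg H h x y - g x y\<bar>) < 1)
      (at (0, 0) within {0<..<H0} \<times> {0<..<H0})"
    using assms(1) by (intro order_tendstoD(2)) auto
  then obtain d where d: "d > 0" "\<And>H h. H \<in> {0<..<H0} \<Longrightarrow> h \<in> {0<..<H0} \<Longrightarrow> dist (H, h) (0, 0) < d \<Longrightarrow>
      (SUP (x, y)\<in>D \<times> D. ennreal \<bar>gg H h x y - g x y\<bar>) < 1"
    unfolding eventually_at by (auto simp del: dist_Pair_Pair)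
  show ?thesis
  \<comment> \<open>With both indices below d/2, the Euclidean distance to the origin is at most
    their sum, hence below d.\<close>
  proof (rule that[of "min H0 (d / 2)" "L + 1"])
    fix H h x y
    assume a: "H \<in> {0<..<min H0 (d / 2)}" "h \<in> {0<..<min H0 (d / 2)}" "x \<in> D" "y \<in> D"
    have "dist (H, h) (0, 0) \<le> H + h"
      using a sqrt_sum_squares_le_sum[of H h] by (simp add: dist_Pair_Pair)
    then have "dist (H, h) (0, 0) < d"
      using a by simp
    then have "(SUP (x, y)\<in>D \<times> D. ennreal \<bar>gg H h x y - g x y\<bar>) < 1"
      using a by (intro d) auto
    moreover have "ennreal \<bar>gg H h x y - g x y\<bar> \<le> (SUP (x, y)\<in>D \<times> D. ennreal \<bar>gg H h x y - g x y\<bar>)"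
      using a by (intro SUP_upper2[of "(x, y)"]) auto
    ultimately have "ennreal \<bar>gg H h x y - g x y\<bar> < 1"
      by (rule le_less_trans[rotated])
    then have "\<bar>gg H h x y - g x y\<bar> < 1"
      by simp
    then show "\<bar>gg H h x y\<bar> \<le> L + 1"
      using L(2)[OF a(3,4)] by linarith
  qed (use d L assms in auto)
qed

section \<open>Choice of \<open>Hbar\<close> and conclusion\<close>

theorem corollary3p6:
  fixes M :: "'w measure"
    and D A :: "'a::euclidean_space set"
    and X :: "real \<Rightarrow> 'a \<Rightarrow> 'w \<Rightarrow> real"
    and C :: "real \<Rightarrow> real \<Rightarrow> real"
    and gg :: "real \<Rightarrow> real \<Rightarrow> 'a \<Rightarrow> 'a \<Rightarrow> real"
    and g :: "'a \<Rightarrow> 'a \<Rightarrow> real"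
    and H0 \<alpha> \<gamma> \<epsilon> :: real
  assumes domain: "open D" "connected D" "D \<noteq> {}" "bounded D"
    and H0: "0 < H0" "H0 < 1/2"
    and fields: "fractional_brownian_fields M D H0 X C gg"
    and standing1:
      "((\<lambda>Hbar. SUP (h, H)\<in>{0<..<Hbar} \<times> {0<..<Hbar}. ennreal \<bar>C h H - 1\<bar>) \<longlongrightarrow> 0) (at_right 0)"
    and g_bounded: "bounded ((\<lambda>(x, y). g x y) ` (D \<times> D))"
    and standing2:
      "((\<lambda>(H, h). SUP (x, y)\<in>D \<times> D. ennreal \<bar>gg H h x y - g x y\<bar>) \<longlongrightarrow> 0)
         (at (0, 0) within {0<..<H0} \<times> {0<..<H0})"
    and A: "A \<in> sets lebesgue" "A \<subseteq> D"
    and \<gamma>: "\<gamma> > 0"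
    and \<alpha>: "\<alpha> > \<gamma>"
    and \<epsilon>: "\<epsilon> > 0"
  shows "\<exists>Hbar\<in>{0<..<H0}.
           (SUP H\<in>{0<..Hbar/2}. \<integral>\<^sup>+\<omega>. bad_mass M X \<alpha> \<gamma> H Hbar A \<omega> \<partial>M) \<le> ennreal \<epsilon>"
proof -
  interpret fractional_brownian_fields M D H0 X C gg by fact
  \<comment> \<open>This minimises the idealised Chernoff exponent, l times (\<gamma> + l/2 -
    \<alpha>) times u.\<close>
  define l where "l = \<alpha> - \<gamma>"
  define \<delta> where "\<delta> = (\<alpha> - \<gamma>) / (2 * (\<alpha> + \<gamma>))"
  have l: "l > 0" and \<delta>: "\<delta> > 0" using \<gamma> \<alpha> by (auto simp: l_def \<delta>_def)
  obtain b where b: "b > 0" "\<And>h H. h \<in> {0<..<b} \<Longrightarrow> H \<in> {0<..<b} \<Longrightarrow> C h H \<le> 1 + \<delta>"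
    using constants_bounded_near_zero[OF standing1 \<delta>] by blast
  obtain b' K where b': "0 < b'" "b' \<le> H0" "0 \<le> K" "\<And>H h x y. H \<in> {0<..<b'} \<Longrightarrow>
      h \<in> {0<..<b'} \<Longrightarrow> x \<in> D \<Longrightarrow> y \<in> D \<Longrightarrow> \<bar>gg H h x y\<bar> \<le> K"
    using kernels_bounded_near_zero[OF standing2 g_bounded H0(1)] by blast
  define v where "v = measure lebesgue D"
  have D: "D \<in> sets lebesgue" "emeasure lebesgue D = ennreal v"
    unfolding v_def using domain
    by (intro fmeasurableD emeasure_eq_measure2 lmeasurable_open; simp)+
  have "v \<ge> 0" by (simp add: v_def)
  \<comment> \<open>The rate combines the remaining gap l/4 with the bound n/3 for 1/(h+H);
    \<open>E\<close> below collects the contribution of the kernels.\<close>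
  define r where "r = exp (- (l * (l / 12)))"
  have r: "0 < r" "r < 1" using l by (auto simp: r_def)
  define E where "E = exp (l * (\<alpha> * K))"
  have "(\<lambda>N. E * (r ^ N / (1 - r)) * v) \<longlonglongrightarrow> E * (0 / (1 - r)) * v"
    using r by (intro tendsto_intros LIMSEQ_power_zero) auto
  then have "eventually (\<lambda>N. E * (r ^ N / (1 - r)) * v < \<epsilon>) sequentially"
    using \<epsilon> by (intro order_tendstoD(2)) auto
  then have "eventually (\<lambda>N. N \<ge> 1 \<and> E * (r ^ N / (1 - r)) * v < \<epsilon>) sequentially"
    using eventually_ge_at_top by (rule eventually_conj[rotated])
  then obtain N where N: "N \<ge> 1" "E * (r ^ N / (1 - r)) * v < \<epsilon>"
    using eventually_happens'[OF sequentially_bot] by blast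
  \<comment> \<open>The bounds b and b' put all scales where the uniform estimates hold, and 1/N
    forces every scale index to be at least N. The choice precedes H, so the final bound is uniform
    in H.\<close>
  obtain Hbar where "0 < Hbar" "Hbar < min (min b b') (1 / real N)"
    using dense[of 0 "min (min b b') (1 / real N)"] b(1) b'(1) N(1) by auto
  then have Hbar: "0 < Hbar" "Hbar < b" "Hbar < b'" "Hbar < 1 / real N" "Hbar < H0"
    using b'(2) by auto
  have "(\<integral>\<^sup>+\<omega>. bad_mass M X \<alpha> \<gamma> H Hbar A \<omega> \<partial>M) \<le> ennreal \<epsilon>" if "H \<in> {0<..Hbar/2}" for H
  proof -
    have H: "0 < H" "H < Hbar" using that Hbar by auto
    define T where "T = {n::nat. 1 / (Hbar - H) < real n \<and> real n \<le> 1 / H}"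
    note T = scale_indices[OF H, folded T_def]
    have N_le: "N \<le> n" if "n \<in> T" for n
    proof -
      have "1 / real n < 1 / real N" using T(3)[OF that] H Hbar by linarith
      then show ?thesis using T(2)[OF that] N by (simp add: field_simps)
    qed
    have "(\<integral>\<^sup>+\<omega>. bad_mass M X \<alpha> \<gamma> H Hbar A \<omega> \<partial>M)
        \<le> (\<Sum>n\<in>T. ennreal (E * r ^ n)) * emeasure lebesgue D"
    proof (rule expected_bad_mass_le[OF D(1) _ H _ A(2) _ T_def])
      fix n x assume n: "n \<in> T" and x: "x \<in> D"
      define h where "h = H + 1 / real n"
      note Tn = T(2-4)[OF n]
      have h: "H < h" "h < Hbar" using Tn H by (auto simp: h_def)
      \<comment> \<open>The left side equals 1 + 2nH, and nH is at most 1.\<close>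
      have "real n * (h + H) \<le> 3"
        using Tn by (simp add: h_def algebra_simps)
      then have u: "1 / (h + H) \<ge> real n / 3"
        using h H by (simp add: field_simps)
      have "\<gamma> * (C H h * (1 / (h + H) + gg H h x x))
          + (\<alpha> - \<gamma>) / 2 * (C h h * (1 / (2 * h) + gg h h x x)) - \<alpha> * (1 / (h + H))
          \<le> \<alpha> * K - (\<alpha> - \<gamma>) / 4 * (1 / (h + H))"
      proof (rule chernoff_exponent_le[OF \<gamma> \<alpha> \<open>0 \<le> K\<close>])
        show "\<bar>gg H h x x\<bar> \<le> K" "\<bar>gg h h x x\<bar> \<le> K"
          using h H Hbar x by (auto intro!: b'(4))
        show "0 < C H h" "0 < C h h" using h H Hbar by (auto intro!: C_pos)
        show "C H h \<le> 1 + (\<alpha> - \<gamma>) / (2 * (\<alpha> + \<gamma>))" "C h h \<le> 1 + (\<alpha> - \<gamma>) / (2 * (\<alpha> + \<gamma>))"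
          unfolding \<delta>_def[symmetric] using h H Hbar by (auto intro!: b(2))
        \<comment> \<open>Since H < h, the leading term of the variance of \<open>X h x\<close> is
          below that of its covariance with \<open>X H x\<close>.\<close>
        show "0 < 1 / (2 * h)" "1 / (2 * h) \<le> 1 / (h + H)"
          using h H by (auto simp: field_simps)
      qed
      also have "\<dots> \<le> \<alpha> * K - (\<alpha> - \<gamma>) / 4 * (real n / 3)"
        using u \<alpha> by (intro diff_left_mono mult_left_mono) auto
      finally have "l * (\<gamma> * (C H h * (1 / (H + h) + gg H h x x))
          + l / 2 * (C h h * (1 / (2 * h) + gg h h x x)) - \<alpha> / (h + H))
          \<le> l * (\<alpha> * K - l / 4 * (real n / 3))"
        using l by (intro mult_left_mono) (auto simp: l_def add.commute)
      also have "\<dots> = ln (E * r ^ n)"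
        by (simp add: E_def r_def ln_mult ln_realpow algebra_simps)
      finally show "l * (\<gamma> * (C H (H + 1 / real n) * (1 / (H + (H + 1 / real n)) + gg H (H + 1 / real n) x x))
        + l / 2 * (C (H + 1 / real n) (H + 1 / real n)
            * (1 / (2 * (H + 1 / real n)) + gg (H + 1 / real n) (H + 1 / real n) x x))
        - \<alpha> / (H + 1 / real n + H)) \<le> ln (E * r ^ n)"
        unfolding h_def .
    qed (use D l r Hbar in \<open>auto simp: E_def\<close>)
    also have "\<dots> = ennreal (E * (\<Sum>n\<in>T. r ^ n) * v)"
      using r \<open>v \<ge> 0\<close> by (simp add: D E_def sum_distrib_left sum_nonneg flip: ennreal_mult)
    also have "\<dots> \<le> ennreal (E * (r ^ N / (1 - r)) * v)"
      using r N_le T(1) \<open>v \<ge> 0\<close>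
      by (intro ennreal_leI mult_right_mono mult_left_mono geometric_tail_le) (auto simp: E_def)
    also have "\<dots> \<le> ennreal \<epsilon>"
      using N by (intro ennreal_leI) simp
    finally show ?thesis .
  qed
  then show ?thesis
    using Hbar by (intro bexI[of _ Hbar] SUP_least) auto
qed

end
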